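(* Consider the system of finite elasticity in conservation form $$\dot{\mathbf F}-\mathrm{Div}(\mathbf v\otimes\mathbf 1)=\mathbf 0,\qquad \dot{\mathbf p}-\mathrm{Div}\,\mathbf S=\mathbf 0,$$ with $\mathbf v=\mathbf V\mathbf p$ and $\mathbf S=\hat{\mathbf S}(\mathbf F)=\partial_{\mathbf F}\hat\sigma(\mathbf F)$, where $\hat\sigma$ is the stored energy (twice continuously differentiable). Let $\mathbf V=\rho^{-1}\mathbf 1$, where $\rho>0$ is interpreted as the referential mass density. Moreover, let the matrix $\mathbf E(\mathbf w)$ be positive for each unit vector $\mathbf w$. Then, for each unit vector $\mathbf w$, the $12\times12$ hyperbolicity matrix $\mathbb M(\mathbf w)$ of the system has zero as a proper value (eigenvalue) of geometric multiplicity six, and has, moreover, exactly three independent proper vectors (eigenvectors) corresponding to non-null proper numbers and giving the possible directions of wave propagation.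
   Context: Vectors are elements of a three-dimensional inner-product space $\mathcal V$; tensors are linear maps of $\mathcal V$ into itself, forming the nine-dimensional space $\mathrm{Lin}$; $\mathbf 1$ is the identity tensor; $(\mathbf z\otimes\mathbf w)\mathbf u=(\mathbf w\cdot\mathbf u)\mathbf z$; $(\mathrm{Div}\,\mathbf S)_i=\sum_j\partial_{x_j}S_{ij}$, and $\mathrm{Div}(\mathbf v\otimes\mathbf 1)=\nabla\mathbf v$ with $(\nabla\mathbf v)_{ij}=\partial_{x_j}v_i$; a superposed dot is the time derivative. The state variables are the tensor $\mathbf F$ (deformation gradient) and the vector $\mathbf p$ (momentum). $\mathbb S=\partial_{\mathbf F}\hat{\mathbf S}=\partial^{(2)}_{\mathbf F\mathbf F}\hat\sigma$ is, at each $\mathbf F$, a linear map $\mathbf Z\mapsto\mathbb S[\mathbf Z]$ of $\mathrm{Lin}$ into itself. For a unit vector $\mathbf w$, $\mathbf E(\mathbf w)$ is the linear transformation of vectors defined by $\mathbf E(\mathbf w)\mathbf u=(\mathbb S[\mathbf u\otimes\mathbf w])\mathbf w$; its positivity for each unit $\mathbf w$ (strong ellipticity of $\hat{\mathbf S}$) means $\mathbf u\cdot\mathbf E(\mathbf w)\mathbf u>0$ for all $\mathbf u\neq\mathbf 0$. For a system of conservation laws $\partial_tU+\sum_\alpha\partial_{x_\alpha}G^\alpha(U)=0$ the hyperbolicity matrix in the direction $\mathbf w$ is $\sum_\alpha w_\alpha\,\partial_UG^\alpha(U)$. For the present system, with $U=(\mathbf F,\mathbf p)\in\mathrm{Lin}\times\mathcal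 V$, it is the linear operator $$\mathbb M(\mathbf w)(\mathbf Z,\mathbf z)=\big(-\rho^{-1}\,\mathbf z\otimes\mathbf w,\ -(\mathbb S[\mathbf Z])\mathbf w\big),\qquad (\mathbf Z,\mathbf z)\in\mathrm{Lin}\times\mathcal V.$$
   Formalization: "Exactly three independent proper vectors" for non-null proper numbers is false as there are six, in pairs for c and −c; what is proved is exactly three for positive proper numbers, exactly three for negative ones, and three independent wave directions shared by these pairs. *)

theory Defs
  imports "HOL-Analysis.Analysis"
begin

text \<open>
  The three-dimensional inner-product space is \<open>real^3\<close> and \<open>Lin\<close> is \<open>real^3^3\<close>.  The library's inner
  product on \<open>real^3^3\<close> is the sum of \<open>A $ i $ j * B $ i $ j\<close>, i.e. the trace inner product of
  \<open>Lin\<close>, so \<open>GDERIV\<close> on \<open>real^3^3\<close> is the usual derivative of the stored energy with respect to a tensor.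
\<close>

type_synonym vec3 = "real^3"
type_synonym tensor3 = "real^3^3"

definition tensor_prod :: "vec3 \<Rightarrow> vec3 \<Rightarrow> tensor3" (infix "\<otimes>\<^sub>t" 72)
  where "z \<otimes>\<^sub>t w = (\<chi> i j. z $ i * w $ j)"

lemma tensor_prod_mult_vec: "(z \<otimes>\<^sub>t w) *v u = (w \<bullet> u) *\<^sub>R z"
  by (simp add: vec_eq_iff tensor_prod_def matrix_vector_mult_def inner_vec_def
      sum_distrib_left sum_distrib_right ac_simps)

definition Div :: "(vec3 \<Rightarrow> tensor3) \<Rightarrow> vec3 \<Rightarrow> vec3"
  where "Div S x = (\<chi> i. \<Sum>j\<in>UNIV. frechet_derivative S (at x) (axis j 1) $ i $ j)"


text \<open>
  A system of conservation laws in three space variables is given by its fluxes \<open>G \<alpha>\<close>; the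
  \<open>12 \<times> 12\<close> matrix is taken as a linear operator on the state space \<open>real^3^3 \<times> real^3\<close>.
\<close>

definition hyperbolicity_operator ::
    "(3 \<Rightarrow> 'a::real_normed_vector \<Rightarrow> 'a) \<Rightarrow> vec3 \<Rightarrow> 'a \<Rightarrow> 'a \<Rightarrow> 'a"
  where "hyperbolicity_operator G w U =
    (\<lambda>H. \<Sum>\<alpha>\<in>UNIV. (w $ \<alpha>) *\<^sub>R frechet_derivative (G \<alpha>) (at U) H)"

definition elasticity_flux ::
    "tensor3 \<Rightarrow> (tensor3 \<Rightarrow> tensor3) \<Rightarrow> 3 \<Rightarrow> tensor3 \<times> vec3 \<Rightarrow> tensor3 \<times> vec3"
  where "elasticity_flux V Shat \<alpha> =
    (\<lambda>(F, p). (- ((V *v p) \<otimes>\<^sub>t axis \<alpha> 1), - (Shat F *v axis \<alpha> 1)))"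

definition acoustic :: "(tensor3 \<Rightarrow> tensor3) \<Rightarrow> vec3 \<Rightarrow> vec3 \<Rightarrow> vec3"
  where "acoustic L w u = L (u \<otimes>\<^sub>t w) *v w"

definition proper_vector :: "('a::real_vector \<Rightarrow> 'a) \<Rightarrow> real \<Rightarrow> 'a \<Rightarrow> bool"
  where "proper_vector M c x \<longleftrightarrow> x \<noteq> 0 \<and> M x = c *\<^sub>R x"

definition proper_space :: "('a::real_vector \<Rightarrow> 'a) \<Rightarrow> real \<Rightarrow> 'a set"
  where "proper_space M c = {x. M x = c *\<^sub>R x}"


lemma linear_tensor_prod_left: "linear (\<lambda>z. z \<otimes>\<^sub>t w)"
  by (rule linearI) (simp_all add: tensor_prod_def vec_eq_iff algebra_simps)

lemma linear_matrix_vec_left: "linear (\<lambda>A::tensor3. A *v w)"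
  by (rule linearI) (simp_all add: matrix_vector_mult_add_rdistrib scaleR_matrix_vector_assoc)

lemma has_derivative_elasticity_flux:
  assumes "(Shat has_derivative L) (at F)"
  shows "(elasticity_flux V Shat \<alpha> has_derivative
      (\<lambda>(Z, z). (- ((V *v z) \<otimes>\<^sub>t axis \<alpha> 1), - (L Z *v axis \<alpha> 1)))) (at (F, p))"
proof -
  have l: "linear (\<lambda>z. (V *v z) \<otimes>\<^sub>t axis \<alpha> 1)"
    using linear_compose[OF matrix_vector_mul_linear[of V] linear_tensor_prod_left]
    by (simp add: o_def)
  have "((\<lambda>U::tensor3 \<times> vec3. (V *v snd U) \<otimes>\<^sub>t axis \<alpha> 1) has_derivative
        (\<lambda>H. (V *v snd H) \<otimes>\<^sub>t axis \<alpha> 1)) (at (F, p))"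
    by (rule bounded_linear.has_derivative[OF linear_conv_bounded_linear[THEN iffD1, OF l]])
      (rule has_derivative_snd[OF has_derivative_ident])
  moreover have "((\<lambda>U. Shat (fst U)) has_derivative (\<lambda>H. L (fst H))) (at (F, p))"
    by (rule has_derivative_compose[OF has_derivative_fst[OF has_derivative_ident]])
      (simp add: assms)
  then have "((\<lambda>U. Shat (fst U) *v axis \<alpha> 1) has_derivative
        (\<lambda>H. L (fst H) *v axis \<alpha> 1)) (at (F, p))"
    by (rule bounded_linear.has_derivative[OF
          linear_conv_bounded_linear[THEN iffD1, OF linear_matrix_vec_left]])
  ultimately show ?thesis
    unfolding elasticity_flux_def case_prod_unfold
    by (intro has_derivative_Pair has_derivative_minus)
qed

text \<open>
  The fluxes yield the system \<open>F\<^sup>\<cdot> - Div (v \<otimes> 1) = 0\<close>, \<open>p\<^sup>\<cdot> - Div S = 0\<close> with \<open>v = V p\<close>, where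
  \<open>Div (v \<otimes> 1)\<close> is the gradient (Jacobian matrix) of \<open>v\<close>.
\<close>

lemma elasticity_flux_divergence:
  assumes "F differentiable (at x)" "p differentiable (at x)" "Shat differentiable (at (F x))"
  shows "(\<Sum>\<alpha>\<in>UNIV. frechet_derivative (\<lambda>y. elasticity_flux V Shat \<alpha> (F y, p y)) (at x) (axis \<alpha> 1))
    = (- jacobian (\<lambda>y. V *v p y) (at x), - Div (\<lambda>y. Shat (F y)) x)"
proof -
  obtain L F' p' where L: "(Shat has_derivative L) (at (F x))"
    and F': "(F has_derivative F') (at x)" and p': "(p has_derivative p') (at x)"
    using assms unfolding differentiable_def by blast
  have v: "frechet_derivative (\<lambda>y. V *v p y) (at x) = (\<lambda>h. V *v p' h)"
    by (rule frechet_derivative_at[symmetric])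
      (rule bounded_linear.has_derivative[OF matrix_vector_mul_bounded_linear p'])
  have S: "frechet_derivative (\<lambda>y. Shat (F y)) (at x) = (\<lambda>h. L (F' h))"
    by (rule frechet_derivative_at[symmetric]) (rule has_derivative_compose[OF F' L])
  have G: "frechet_derivative (\<lambda>y. elasticity_flux V Shat \<alpha> (F y, p y)) (at x)
      = (\<lambda>h. (- ((V *v p' h) \<otimes>\<^sub>t axis \<alpha> 1), - (L (F' h) *v axis \<alpha> 1)))" for \<alpha>
    by (rule frechet_derivative_at[symmetric])
      (use has_derivative_compose[OF has_derivative_Pair[OF F' p'] has_derivative_elasticity_flux[OF L]]
        in simp)
  have 1: "(\<Sum>\<alpha>\<in>UNIV. - ((V *v p' (axis \<alpha> 1)) \<otimes>\<^sub>t axis \<alpha> 1)) = - jacobian (\<lambda>y. V *v p y) (at x)"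
    unfolding jacobian_def v
    by (simp add: vec_eq_iff matrix_def tensor_prod_def axis_def if_distrib sum_negf cong: if_cong)
  have 2: "(\<Sum>\<alpha>\<in>UNIV. - (L (F' (axis \<alpha> 1)) *v axis \<alpha> 1)) = - Div (\<lambda>y. Shat (F y)) x"
    unfolding Div_def S
    by (simp add: vec_eq_iff matrix_vector_mult_def axis_def if_distrib sum_negf cong: if_cong)
  show ?thesis
    unfolding G sum_prod 1 2 ..
qed

lemma hyperbolicity_operator_elasticity:
  assumes "(Shat has_derivative L) (at F)"
  shows "hyperbolicity_operator (elasticity_flux (inverse \<rho> *\<^sub>R mat 1) Shat) w (F, p) (Z, z) =
    (- (inverse \<rho> *\<^sub>R (z \<otimes>\<^sub>t w)), - (L Z *v w))"
proof -
  have 1: "(\<Sum>\<alpha>\<in>UNIV. w $ \<alpha> *\<^sub>R - (((inverse \<rho> *\<^sub>R mat 1) *v z) \<otimes>\<^sub>t axis \<alpha> 1))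
      = - (inverse \<rho> *\<^sub>R (z \<otimes>\<^sub>t w))"
    by (simp add: vec_eq_iff tensor_prod_def axis_def if_distrib sum_negf ac_simps
        scaleR_matrix_vector_assoc[symmetric] cong: if_cong)
  have 2: "(\<Sum>\<alpha>\<in>UNIV. w $ \<alpha> *\<^sub>R - (L Z *v axis \<alpha> 1)) = - (L Z *v w)"
    by (simp add: vec_eq_iff matrix_vector_mult_def axis_def if_distrib sum_negf ac_simps
        cong: if_cong)
  show ?thesis
    unfolding hyperbolicity_operator_def
      frechet_derivative_at[OF has_derivative_elasticity_flux[OF assms], symmetric]
      case_prod_conv scaleR_Pair sum_prod 1 2 ..
qed

text \<open>
  Proper vectors with non-null proper numbers come in pairs, belonging to opposite proper numbers
  and hence independent, with the same wave direction \<open>z\<close>.  So three independent ones can be counted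
  only up to this reversal: three for the positive, three for the negative proper numbers, and three
  wave directions.
\<close>

lemma proper_vector_reverse:
  assumes "(Shat has_derivative L) (at F)"
    and "proper_vector (hyperbolicity_operator (elasticity_flux (inverse \<rho> *\<^sub>R mat 1) Shat) w (F, p))
      c (Z, z)"
  shows "proper_vector (hyperbolicity_operator (elasticity_flux (inverse \<rho> *\<^sub>R mat 1) Shat) w (F, p))
      (- c) (- Z, z)"
proof -
  have "L (- Z) = - L Z"
    using has_derivative_linear[OF assms(1)] by (rule linear_neg)
  moreover have "(- A) *v w = - (A *v w)" for A :: tensor3
    using linear_matrix_vec_left by (rule linear_neg)
  ultimately show ?thesis
    using assms(2)
    by (auto simp: proper_vector_def hyperbolicity_operator_elasticity[OF assms(1)]
        zero_prod_def minus_equation_iff)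
qed

end

theory Submission
  imports Defs
begin

text \<open>
  For \<open>c \<noteq> 0\<close> the proper vectors of the hyperbolicity operator are the pairs
  \<open>(- (\<rho> c)\<^sup>-\<^sup>1 z \<otimes> w, z)\<close> with \<open>z \<noteq> 0\<close> and \<open>E z = \<rho> c\<^sup>2 z\<close>, where \<open>E\<close> is the acoustic tensor in the
  direction \<open>w\<close>.  As \<open>L\<close> is a second derivative of the stored energy, it is symmetric, and so is \<open>E\<close>;
  being positive, it has an orthonormal basis of proper vectors with positive proper numbers.  The
  null space is \<open>{(Z, 0). L Z w = 0}\<close>; since \<open>L (u \<otimes> w) w = E u\<close> and \<open>E\<close> is onto, so is
  \<open>Z \<mapsto> L Z w\<close>, which leaves dimension \<open>9 - 3\<close>.
\<close>

section \<open>Symmetry of the second derivative\<close>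

text \<open>
  The second difference is symmetric in \<open>u\<close> and \<open>v\<close>, which makes the second derivative symmetric.
  It is \<open>t\<close> times a difference of gradients, by the mean value theorem in the direction \<open>u\<close>.
\<close>

lemma tendsto_second_difference:
  fixes \<sigma> :: "'a::real_inner \<Rightarrow> real"
  assumes "open D" "x \<in> D"
    and grad: "\<And>y. y \<in> D \<Longrightarrow> GDERIV \<sigma> y :> G y"
    and G: "(G has_derivative L) (at x)"
  shows "((\<lambda>t. (\<sigma> (x + t *\<^sub>R u + t *\<^sub>R v) - \<sigma> (x + t *\<^sub>R u) - \<sigma> (x + t *\<^sub>R v) + \<sigma> x) / t\<^sup>2)
    \<longlongrightarrow> u \<bullet> L v) (at_right 0)"
proof (rule tendstoI)
  fix \<epsilon> :: real assume "\<epsilon> > 0"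
  let ?q = "\<lambda>t. (\<sigma> (x + t *\<^sub>R u + t *\<^sub>R v) - \<sigma> (x + t *\<^sub>R u) - \<sigma> (x + t *\<^sub>R v) + \<sigma> x) / t\<^sup>2"
  define N where "N = norm u + norm v"
  \<comment> \<open>The final error is at most \<open>2 * N * norm u * e\<close>; the extra 1 in the
    denominator pushes it strictly below \<epsilon> and keeps the quotient meaningful for
    \<open>u = 0\<close>.\<close>
  define e where "e = \<epsilon> / (2 * N * norm u + 1)"
  have N: "N \<ge> 0" by (simp add: N_def)
  have den: "2 * N * norm u + 1 > 0" using N by (simp add: add_nonneg_pos)
  then have "e > 0" using \<open>\<epsilon> > 0\<close> by (simp add: e_def)
  have e: "2 * N * norm u * e < \<epsilon>"
    using den \<open>\<epsilon> > 0\<close> by (simp add: e_def field_simps)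
  obtain d1 where "d1 > 0" and d1: "\<And>y. norm (y - x) < d1 \<Longrightarrow>
      norm (G y - G x - L (y - x)) \<le> e * norm (y - x)"
    using G \<open>e > 0\<close> unfolding has_derivative_at_alt by blast
  obtain d2 where "d2 > 0" and d2: "ball x d2 \<subseteq> D"
    using \<open>open D\<close> \<open>x \<in> D\<close> open_contains_ball by blast
  define d where "d = min d1 d2"
  have "d > 0" using \<open>d1 > 0\<close> \<open>d2 > 0\<close> by (simp add: d_def)
  have inD: "y \<in> D" if "norm (y - x) < d" for y
    using that d2 by (auto simp: d_def dist_norm norm_minus_commute)
  \<comment> \<open>For \<open>t < t0\<close> the whole parallelogram at \<open>x\<close> with sides
    \<open>t *\<^sub>R u\<close> and \<open>t *\<^sub>R v\<close> has distance at most
    \<open>t * N < d\<close> from \<open>x\<close>. The extra 1 covers \<open>N = 0\<close>.\<close>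
  define t0 where "t0 = d / (N + 1)"
  have "t0 > 0" using N \<open>d > 0\<close> by (simp add: t0_def)
  have main: "dist (?q t) (u \<bullet> L v) < \<epsilon>" if t: "0 < t" "t < t0" for t
  proof -
    have "t * (N + 1) < d" using t N by (simp add: t0_def field_simps)
    then have tN: "t * N < d" using t by (simp add: algebra_simps)
    have bd: "norm (s *\<^sub>R u + r *\<^sub>R v) \<le> t * N" if "0 \<le> s" "s \<le> t" "0 \<le> r" "r \<le> t" for s r
    proof -
      have "norm (s *\<^sub>R u + r *\<^sub>R v) \<le> s * norm u + r * norm v"
        using norm_triangle_ineq[of "s *\<^sub>R u" "r *\<^sub>R v"] that by simp
      also have "\<dots> \<le> t * norm u + t * norm v"
        using that by (intro add_mono mult_right_mono) auto
      finally show ?thesis by (simp add: N_def algebra_simps)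
    qed
    have inD': "x + s *\<^sub>R u + r *\<^sub>R v \<in> D" if "0 \<le> s" "s \<le> t" "0 \<le> r" "r \<le> t" for s r
      using bd[OF that] tN by (intro inD) (simp add: add.assoc)
    have der: "((\<lambda>s. \<sigma> (x + s *\<^sub>R u + r *\<^sub>R v)) has_real_derivative
        u \<bullet> G (x + s *\<^sub>R u + r *\<^sub>R v)) (at s)"
      if "0 \<le> s" "s \<le> t" "0 \<le> r" "r \<le> t" for s r
    proof -
      have "((\<lambda>s. x + s *\<^sub>R u + r *\<^sub>R v) has_derivative (\<lambda>h. h *\<^sub>R u)) (at s)"
        by (auto intro!: derivative_eq_intros)
      from has_derivative_compose[OF this grad[OF inD'[OF that], unfolded gderiv_def]]
      show ?thesis
        by (simp add: has_field_derivative_def mult.commute[of _ "u \<bullet> _"])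
    qed
    \<comment> \<open>The second difference is \<open>h t - h 0\<close>. Keeping
      \<open>0 *\<^sub>R v\<close> lets \<open>der\<close> apply to both summands, with
      \<open>r = t\<close> and \<open>r = 0\<close>.\<close>
    define h where "h = (\<lambda>s. \<sigma> (x + s *\<^sub>R u + t *\<^sub>R v) - \<sigma> (x + s *\<^sub>R u + 0 *\<^sub>R v))"
    have "\<exists>z>0. z < t \<and> h t - h 0 = (t - 0) *
        (u \<bullet> G (x + z *\<^sub>R u + t *\<^sub>R v) - u \<bullet> G (x + z *\<^sub>R u + 0 *\<^sub>R v))"
      unfolding h_def using t by (intro MVT2 DERIV_diff der) auto
    then obtain z where z: "0 < z" "z < t" and hz: "h t - h 0 = t *
        (u \<bullet> (G (x + z *\<^sub>R u + t *\<^sub>R v) - G (x + z *\<^sub>R u)))"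
      by (auto simp: inner_diff_right)
    define R where "R = (\<lambda>y. G y - G x - L (y - x))"
    have R: "norm (R (x + s *\<^sub>R u + r *\<^sub>R v)) \<le> e * (t * N)"
      if "0 \<le> s" "s \<le> t" "0 \<le> r" "r \<le> t" for s r
    proof -
      have "norm (R (x + s *\<^sub>R u + r *\<^sub>R v)) \<le> e * norm (s *\<^sub>R u + r *\<^sub>R v)"
        using d1[of "x + s *\<^sub>R u + r *\<^sub>R v"] bd[OF that] tN by (simp add: R_def d_def add.assoc)
      also have "\<dots> \<le> e * (t * N)" using bd[OF that] \<open>e > 0\<close> by simp
      finally show ?thesis .
    qed
    define y1 y2 where "y1 = x + z *\<^sub>R u + t *\<^sub>R v" and "y2 = x + z *\<^sub>R u"
    have "linear L" using G by (rule has_derivative_linear)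
    \<comment> \<open>Both gradients are linearised at \<open>x\<close>, the one point where
      \<open>L\<close> is the derivative. As \<open>y1 - y2 = t *\<^sub>R v\<close>, the linear
      parts leave \<open>t *\<^sub>R L v\<close>; the remainders are of order \<open>e * t\<close>,
      and the mean value theorem supplies the other factor \<open>t\<close>.\<close>
    then have "G y1 - G y2 = t *\<^sub>R L v + (R y1 - R y2)"
      by (simp add: R_def y1_def y2_def linear_add linear_scale add.assoc)
    then have "h t - h 0 = t\<^sup>2 * (u \<bullet> L v) + t * (u \<bullet> (R y1 - R y2))"
      using hz by (simp add: y1_def y2_def inner_add_right power2_eq_square distrib_left)
    then have "?q t - u \<bullet> L v = (u \<bullet> (R y1 - R y2)) / t"
      using t by (simp add: h_def field_simps power2_eq_square)
    moreover have "\<bar>u \<bullet> (R y1 - R y2)\<bar> \<le> norm u * (2 * (e * (t * N)))"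
    proof -
      have "norm (R y1 - R y2) \<le> norm (R y1) + norm (R y2)" by (rule norm_triangle_ineq4)
      also have "\<dots> \<le> 2 * (e * (t * N))"
        using R[of z t] R[of z 0] z t by (simp add: y1_def y2_def)
      finally show ?thesis
        using Cauchy_Schwarz_ineq2[of u "R y1 - R y2"] by (meson mult_left_mono norm_ge_zero order_trans)
    qed
    then have "\<bar>u \<bullet> (R y1 - R y2)\<bar> / t \<le> 2 * N * norm u * e"
      using t by (simp add: field_simps)
    ultimately show ?thesis using e t by (simp add: dist_real_def)
  qed
  show "eventually (\<lambda>t. dist (?q t) (u \<bullet> L v) < \<epsilon>) (at_right 0)"
    unfolding eventually_at_right_field using \<open>t0 > 0\<close> main by blast
qed

lemma second_derivative_symmetric:
  fixes \<sigma> :: "'a::real_inner \<Rightarrow> real"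
  assumes "open D" "x \<in> D"
    and "\<And>y. y \<in> D \<Longrightarrow> GDERIV \<sigma> y :> G y"
    and "(G has_derivative L) (at x)"
  shows "u \<bullet> L v = v \<bullet> L u"
proof (rule tendsto_unique[OF _ tendsto_second_difference[OF assms]])
  show "((\<lambda>t. (\<sigma> (x + t *\<^sub>R u + t *\<^sub>R v) - \<sigma> (x + t *\<^sub>R u) - \<sigma> (x + t *\<^sub>R v) + \<sigma> x) / t\<^sup>2)
      \<longlongrightarrow> v \<bullet> L u) (at_right 0)"
    using tendsto_second_difference[OF assms, of v u] by (simp add: algebra_simps)
qed simp

section \<open>Spectral theorem for symmetric operators\<close>

text \<open>The quadratic form of \<open>f\<close> attains its maximum on the compact unit sphere of
  \<open>S\<close>, and a maximiser is an eigenvector whose eigenvalue is that maximum.\<close>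

lemma symmetric_has_eigenvector:
  fixes f :: "'a::euclidean_space \<Rightarrow> 'a"
  assumes f: "linear f" and sym: "\<And>x y. x \<bullet> f y = y \<bullet> f x"
    and S: "subspace S" "f ` S \<subseteq> S" "S \<noteq> {0}"
  obtains x c where "x \<in> S" "norm x = 1" "f x = c *\<^sub>R x"
proof -
  have "compact (sphere 0 1 \<inter> S)"
    by (intro compact_Int_closed compact_sphere closed_subspace S)
  moreover have "sphere 0 1 \<inter> S \<noteq> {}"
  proof -
    obtain y where "y \<in> S" "y \<noteq> 0" using S subspace_0 by blast
    then have "y /\<^sub>R norm y \<in> sphere 0 1 \<inter> S" using S by (simp add: subspace_scale)
    then show ?thesis by blast
  qed
  moreover have "continuous_on (sphere 0 1 \<inter> S) (\<lambda>x. x \<bullet> f x)"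
    by (intro continuous_intros linear_continuous_on linear_conv_bounded_linear[THEN iffD1, OF f])
  ultimately have "\<exists>x\<in>sphere 0 1 \<inter> S. \<forall>y\<in>sphere 0 1 \<inter> S. y \<bullet> f y \<le> x \<bullet> f x"
    by (rule continuous_attains_sup)
  then obtain x where x: "x \<in> S" "norm x = 1"
    and max: "\<And>y. y \<in> S \<Longrightarrow> norm y = 1 \<Longrightarrow> y \<bullet> f y \<le> x \<bullet> f x"
    by (metis IntD1 IntD2 IntI mem_sphere_0)
  define m where "m = x \<bullet> f x"
  define g where "g = (\<lambda>y. m * (y \<bullet> y) - y \<bullet> f y)"
  have g: "g y \<ge> 0" if "y \<in> S" for y
  proof (cases "y = 0")
    case False
    then have "(y /\<^sub>R norm y) \<bullet> f (y /\<^sub>R norm y) \<le> m"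
      unfolding m_def using that S by (intro max) (simp_all add: subspace_scale)
    then have "y \<bullet> f y / (norm y * norm y) \<le> m"
      by (simp add: linear_scale[OF f] divide_simps)
    then show ?thesis
      using False by (simp add: g_def divide_le_eq dot_square_norm power2_eq_square)
  qed (simp add: g_def)
  \<comment> \<open>The form \<open>g \<ge> 0\<close> vanishes at \<open>x\<close>; its first variation there in the direction \<open>y\<close> is \<open>2 (y \<bullet> y)\<close>.\<close>
  define y where "y = m *\<^sub>R x - f x"
  have y: "y \<in> S" unfolding y_def using x S by (intro subspace_diff subspace_scale) auto
  \<comment> \<open>Moving from \<open>x\<close> along \<open>y\<close> changes \<open>g\<close> by
    \<open>2 * t * (y \<bullet> y) + t\<^sup>2 * g y\<close>, which is negative for small negative
    \<open>t\<close> unless \<open>y = 0\<close>. This \<open>t\<close> is small enough, and the 1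
    keeps the denominator positive when \<open>g y = 0\<close>.\<close>
  define t where "t = - (y \<bullet> y) / (g y + 1)"
  have "g (x + t *\<^sub>R y) = 2 * t * (m * (x \<bullet> y) - y \<bullet> f x) + t\<^sup>2 * g y"
    using x(2) sym[of x y]
    by (simp add: g_def m_def linear_add[OF f] linear_scale[OF f] inner_add_left inner_add_right
        norm_eq_1 inner_commute[of y x] power2_eq_square algebra_simps)
  also have "m * (x \<bullet> y) - y \<bullet> f x = y \<bullet> y"
    by (simp add: y_def inner_diff_right inner_diff_left inner_commute algebra_simps)
  finally have "0 \<le> 2 * t * (y \<bullet> y) + t\<^sup>2 * g y"
    using g[of "x + t *\<^sub>R y"] x y S by (simp add: subspace_add subspace_scale)
  then have "0 \<le> (g y + 1)\<^sup>2 * (2 * t * (y \<bullet> y) + t\<^sup>2 * g y)"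
    by (intro mult_nonneg_nonneg) auto
  also have "\<dots> = 2 * (g y + 1) * (t * (g y + 1)) * (y \<bullet> y) + (t * (g y + 1))\<^sup>2 * g y"
    by (simp only: power2_eq_square algebra_simps)
  also have "t * (g y + 1) = - (y \<bullet> y)" using g[OF y] by (simp add: t_def)
  also have "2 * (g y + 1) * - (y \<bullet> y) * (y \<bullet> y) + (- (y \<bullet> y))\<^sup>2 * g y
      = - ((y \<bullet> y)\<^sup>2 * (g y + 2))"
    by (simp add: power2_eq_square algebra_simps)
  finally have "(y \<bullet> y)\<^sup>2 * (g y + 2) \<le> 0" by simp
  then have "y = 0" using g[OF y] by (auto simp: mult_le_0_iff)
  then have "f x = m *\<^sub>R x" by (simp add: y_def)
  with x show ?thesis by (rule that)
qed

text \<open>Induction on the dimension: a unit eigenvector \<open>x\<close> is split off, and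
  symmetry makes its orthogonal complement in \<open>S\<close> invariant again. The statement speaks
  of invariant subspaces so that the induction hypothesis applies to that complement.\<close>

lemma symmetric_orthonormal_eigenbasis:
  fixes f :: "'a::euclidean_space \<Rightarrow> 'a"
  assumes f: "linear f" and sym: "\<And>x y. x \<bullet> f y = y \<bullet> f x"
    and "subspace S" "f ` S \<subseteq> S"
  shows "\<exists>B\<subseteq>S. finite B \<and> card B = dim S \<and> pairwise orthogonal B \<and>
    (\<forall>b\<in>B. norm b = 1 \<and> (\<exists>c. f b = c *\<^sub>R b))"
  using assms(3,4)
proof (induction "dim S" arbitrary: S)
  case 0
  then show ?case by (intro exI[of _ "{}"]) auto
next
  case (Suc n)
  then have "S \<noteq> {0}" by auto
  with f sym Suc.prems obtain x c where x: "x \<in> S" "norm x = 1" "f x = c *\<^sub>R x"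
    by (rule symmetric_has_eigenvector)
  define T where "T = {y \<in> S. \<forall>z\<in>span {x}. orthogonal z y}"
  have T: "T = S \<inter> {y. x \<bullet> y = 0}"
    by (auto simp: T_def orthogonal_def span_singleton)
  have "span {x} \<subseteq> S" using x Suc.prems by (simp add: span_minimal)
  then have "dim T + dim (span {x}) = dim S"
    unfolding T_def using Suc.prems by (intro dim_subspace_orthogonal_to_vectors) auto
  moreover have "dim {x} = 1" using x by (auto simp: dim_insert)
  ultimately have n: "n = dim T" using Suc.hyps(2) by simp
  have sT: "subspace T" unfolding T
    using Suc.prems by (intro subspace_inter) (auto simp: subspace_hyperplane)
  \<comment> \<open>For \<open>y\<close> in \<open>T\<close>,
    \<open>x \<bullet> f y = y \<bullet> f x = c * (y \<bullet> x) = 0\<close>.\<close>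
  have "f ` T \<subseteq> T"
    using Suc.prems sym[of x] x by (auto simp: T inner_commute)
  from Suc.hyps(1)[OF n sT this] obtain B where B: "B \<subseteq> T" "finite B" "card B = dim T"
    "pairwise orthogonal B" "\<forall>b\<in>B. norm b = 1 \<and> (\<exists>c. f b = c *\<^sub>R b)" by blast
  have "x \<notin> B" using B(1) x by (auto simp: T)
  then show ?case
    using B x n Suc.hyps(2)
    by (intro exI[of _ "insert x B"])
      (auto simp: T pairwise_insert orthogonal_def inner_commute)
qed

section \<open>Kernel of a surjective linear map\<close>

text \<open>The kernel is the orthogonal complement of the range of the adjoint, and the adjoint of
  a surjective map is injective, so that range has the dimension of the codomain.\<close>

lemma dim_kernel_surj:
  fixes f :: "'a::euclidean_space \<Rightarrow> 'b::euclidean_space"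
  assumes f: "linear f" and "surj f"
  shows "dim {x. f x = 0} + DIM('b) = DIM('a)"
proof -
  have la: "linear (adjoint f)" using f by (rule adjoint_linear)
  have "{x. f x = 0} = {x \<in> UNIV. \<forall>y \<in> range (adjoint f). orthogonal y x}"
    by (auto simp: orthogonal_def adjoint_clauses[OF f]) (metis inner_eq_zero_iff)
  then have "dim {x. f x = 0} + dim (range (adjoint f)) = DIM('a)"
    using dim_subspace_orthogonal_to_vectors[of "range (adjoint f)" UNIV] la
    by (simp add: linear_subspace_image)
  moreover have "inj (adjoint f)"
    unfolding linear_injective_0[OF la]
  proof (intro allI impI)
    fix y assume "adjoint f y = 0"
    then have "y \<bullet> f x = 0" for x
      by (metis adjoint_clauses(2)[OF f] inner_zero_left)
    then show "y = 0" using \<open>surj f\<close> by (metis inner_eq_zero_iff surjD)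
  qed
  then have "dim (range (adjoint f)) = DIM('b)"
    using dim_image_eq[OF la, of UNIV] by simp
  ultimately show ?thesis by simp
qed

section \<open>Acoustic tensor and proper vectors of the elasticity operator\<close>

lemma inner_tensor_prod: "(u \<otimes>\<^sub>t w) \<bullet> A = u \<bullet> (A *v w)"
  by (simp add: inner_vec_def tensor_prod_def matrix_vector_mult_def sum_distrib_left ac_simps)

lemma linear_acoustic: "linear L \<Longrightarrow> linear (acoustic L w)"
  unfolding acoustic_def
  using linear_compose[OF linear_compose[OF linear_tensor_prod_left] linear_matrix_vec_left]
  by (simp add: o_def)

text \<open>The form \<open>u \<bullet> acoustic L w v\<close> is the restriction of the form of
  \<open>L\<close> to the tensors \<open>u \<otimes>\<^sub>t w\<close> and
  \<open>v \<otimes>\<^sub>t w\<close>, so symmetry is inherited.\<close>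

lemma acoustic_symmetric:
  assumes "\<And>A B. A \<bullet> L B = B \<bullet> L A"
  shows "u \<bullet> acoustic L w v = v \<bullet> acoustic L w u"
  unfolding acoustic_def inner_tensor_prod[symmetric] by (rule assms)

text \<open>Since \<open>c\<close> is non-null, the first component of the proper vector equation
  can be solved for \<open>Z\<close>; inserted into the second it leaves an eigenvalue equation for
  \<open>z\<close> alone. If \<open>z\<close> vanished, so would \<open>Z\<close>.\<close>

lemma elasticity_proper_vector_iff:
  assumes L: "(Shat has_derivative L) (at F)" and "\<rho> \<noteq> 0" and "c \<noteq> 0"
  shows "proper_vector (hyperbolicity_operator (elasticity_flux (inverse \<rho> *\<^sub>R mat 1) Shat) w (F, p))
      c (Z, z) \<longleftrightarrow>
    z \<noteq> 0 \<and> Z = - (inverse (\<rho> * c) *\<^sub>R (z \<otimes>\<^sub>t w)) \<and> acoustic L w z = (\<rho> * c\<^sup>2) *\<^sub>R z"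
proof -
  have lL: "linear L" using L by (rule has_derivative_linear)
  have Z: "- (inverse \<rho> *\<^sub>R (z \<otimes>\<^sub>t w)) = c *\<^sub>R Z \<longleftrightarrow> Z = - (inverse (\<rho> * c) *\<^sub>R (z \<otimes>\<^sub>t w))"
  proof -
    have "- (inverse \<rho> *\<^sub>R X) = c *\<^sub>R Z \<longleftrightarrow> Z = - (inverse (\<rho> * c) *\<^sub>R X)" for X :: tensor3
      using assms(2,3) by (auto simp: vec_eq_iff field_simps)
    then show ?thesis .
  qed
  have z: "- (L Z *v w) = c *\<^sub>R z \<longleftrightarrow> acoustic L w z = (\<rho> * c\<^sup>2) *\<^sub>R z"
    if "Z = - (inverse (\<rho> * c) *\<^sub>R (z \<otimes>\<^sub>t w))"
  proof -
    have "- (L Z *v w) = inverse (\<rho> * c) *\<^sub>R acoustic L w z"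
      unfolding that acoustic_def
      by (simp add: linear_neg[OF lL] linear_scale[OF lL] linear_neg[OF linear_matrix_vec_left]
          linear_scale[OF linear_matrix_vec_left])
    moreover have "(inverse (\<rho> * c) *\<^sub>R x = c *\<^sub>R z) \<longleftrightarrow> x = (\<rho> * c\<^sup>2) *\<^sub>R z" for x :: vec3
      using assms(2,3) by (auto simp: vec_eq_iff power2_eq_square field_simps)
    ultimately show ?thesis by simp
  qed
  have "0 \<otimes>\<^sub>t w = 0" by (simp add: tensor_prod_def vec_eq_iff)
  then show ?thesis
    unfolding proper_vector_def hyperbolicity_operator_elasticity[OF L] scaleR_Pair prod.inject Z
    using z by (auto simp: zero_prod_def)
qed

lemma dim_elasticity_kernel:
  assumes L: "(Shat has_derivative L) (at F)" and "\<rho> \<noteq> 0" and "w \<noteq> 0"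
    and inj: "inj (acoustic L w)"
  shows "dim (proper_space
    (hyperbolicity_operator (elasticity_flux (inverse \<rho> *\<^sub>R mat 1) Shat) w (F, p)) 0) = 6"
proof -
  have lL: "linear L" using L by (rule has_derivative_linear)
  define f where "f = (\<lambda>Z. L Z *v w)"
  have f: "linear f"
    unfolding f_def using linear_compose[OF lL linear_matrix_vec_left] by (simp add: o_def)
  have "surj (acoustic L w)"
    using linear_injective_imp_surjective[OF linear_acoustic[OF lL] inj] by simp
  moreover have "acoustic L w = f \<circ> (\<lambda>u. u \<otimes>\<^sub>t w)"
    by (simp add: fun_eq_iff acoustic_def f_def)
  ultimately have "surj f" by (auto simp: surj_def o_def)
  then have "dim {Z. f Z = 0} = 6"
    using dim_kernel_surj[OF f] by simp
  moreover have "proper_space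
      (hyperbolicity_operator (elasticity_flux (inverse \<rho> *\<^sub>R mat 1) Shat) w (F, p)) 0
    = (\<lambda>Z. (Z, 0)) ` {Z. f Z = 0}"
  proof -
    \<comment> \<open>Applying \<open>z \<otimes>\<^sub>t w\<close> to \<open>w\<close> gives a
      positive multiple of \<open>z\<close>. Hence null vectors of the operator have vanishing
      second component.\<close>
    have "z = 0" if "z \<otimes>\<^sub>t w = 0" for z
      using tensor_prod_mult_vec[of z w w] that \<open>w \<noteq> 0\<close> by simp
    moreover have "0 \<otimes>\<^sub>t w = 0" by (simp add: tensor_prod_def vec_eq_iff)
    ultimately show ?thesis
      using \<open>\<rho> \<noteq> 0\<close>
      by (auto simp: proper_space_def hyperbolicity_operator_elasticity[OF L] zero_prod_def f_def)
  qed
  moreover have "dim ((\<lambda>Z. (Z, 0::vec3)) ` {Z. f Z = 0}) = dim {Z. f Z = 0}"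
    by (rule dim_image_eq) (auto intro!: linearI inj_onI)
  ultimately show ?thesis by simp
qed

text \<open>The values of \<kappa> are the wave speeds: an eigenvalue \<open>k\<close> of the
  acoustic tensor is positive by \<open>pos\<close>, and solving
  \<open>k = \<rho> * c\<^sup>2\<close> gives \<open>c = sqrt (k / \<rho>)\<close>.\<close>

lemma elasticity_eigenbasis:
  assumes L: "(Shat has_derivative L) (at F)" and "\<rho> > 0"
    and sym: "\<And>A B. A \<bullet> L B = B \<bullet> L A"
    and pos: "\<And>u. u \<noteq> 0 \<Longrightarrow> u \<bullet> acoustic L w u > 0"
  obtains B \<kappa> where "finite B" "card B = 3" "pairwise orthogonal B" "span B = UNIV"
    "\<forall>b\<in>B. norm b = 1 \<and> \<kappa> b > 0 \<and> acoustic L w b = (\<rho> * (\<kappa> b)\<^sup>2) *\<^sub>R b"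
proof -
  obtain B where B: "finite B" "card B = dim (UNIV :: vec3 set)" "pairwise orthogonal B"
    "\<forall>b\<in>B. norm b = 1 \<and> (\<exists>c. acoustic L w b = c *\<^sub>R b)"
    using symmetric_orthonormal_eigenbasis[OF linear_acoustic acoustic_symmetric, of L UNIV w]
      has_derivative_linear[OF L] sym by auto
  have "0 \<notin> B" using B(4) by auto
  then have "independent B" using B(3) by (intro pairwise_orthogonal_independent)
  then have "span B = UNIV"
    using card_ge_dim_independent[of B UNIV] B(2) by auto
  moreover have "\<forall>b\<in>B. \<exists>c>0. acoustic L w b = (\<rho> * c\<^sup>2) *\<^sub>R b"
  proof
    fix b assume "b \<in> B"
    then obtain k where k: "norm b = 1" "acoustic L w b = k *\<^sub>R b" using B(4) by blast
    have "b \<noteq> 0" using k by auto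
    then have "k > 0" using pos[of b] k by (simp add: dot_square_norm)
    then show "\<exists>c>0. acoustic L w b = (\<rho> * c\<^sup>2) *\<^sub>R b"
      using k \<open>\<rho> > 0\<close> by (intro exI[of _ "sqrt (k / \<rho>)"]) simp
  qed
  then obtain \<kappa> where "\<forall>b\<in>B. \<kappa> b > 0 \<and> acoustic L w b = (\<rho> * (\<kappa> b)\<^sup>2) *\<^sub>R b"
    by metis
  ultimately show ?thesis using that[of B \<kappa>] B by simp
qed

section \<open>Counting proper vectors with non-null proper numbers\<close>

text \<open>The set collects proper vectors for different \<open>c\<close> and need not be a
  subspace; \<open>dim\<close> measures its span. An injective linear map \<open>T\<close> on the
  wave directions bounds it from both sides: the set contains the image of an eigenbasis and lies in
  the range of \<open>T\<close>, both of dimension three.\<close>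

lemma dim_elasticity_positive:
  assumes L: "(Shat has_derivative L) (at F)" and "\<rho> > 0"
    and sym: "\<And>A B. A \<bullet> L B = B \<bullet> L A"
    and pos: "\<And>u. u \<noteq> 0 \<Longrightarrow> u \<bullet> acoustic L w u > 0"
  shows "dim {x. \<exists>c>0. proper_vector
    (hyperbolicity_operator (elasticity_flux (inverse \<rho> *\<^sub>R mat 1) Shat) w (F, p)) c x} = 3"
    (is "dim ?X = 3")
proof -
  obtain B \<kappa> where B0: "finite B" "card B = 3" "pairwise orthogonal B" "span B = UNIV"
    "\<forall>b\<in>B. norm b = 1 \<and> \<kappa> b > 0 \<and> acoustic L w b = (\<rho> * (\<kappa> b)\<^sup>2) *\<^sub>R b"
    by (rule elasticity_eigenbasis[OF assms])
  then have B: "norm b = 1" "\<kappa> b > 0" "acoustic L w b = (\<rho> * (\<kappa> b)\<^sup>2) *\<^sub>R b" if "b \<in> B" for b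
    using that by auto
  note iff = elasticity_proper_vector_iff[OF L]
  have expand: "(\<Sum>b\<in>B. (z \<bullet> b) *\<^sub>R b) = z" for z
    using orthonormal_basis_expand[OF B0(3) B(1) _ B0(1)] B0(4) by simp
  \<comment> \<open>On proper vectors with \<open>E z = \<rho> c\<^sup>2 z\<close>, \<open>c > 0\<close>, the operator \<open>R = (\<rho> E)\<^sup>-\<^sup>1\<^sup>/\<^sup>2\<close> is division by
    \<open>\<rho> c\<close>; thus all positive proper vectors lie in the range of the single linear map \<open>T\<close>.\<close>
  define R where "R = (\<lambda>z. \<Sum>b\<in>B. (inverse (\<rho> * \<kappa> b) * (z \<bullet> b)) *\<^sub>R b)"
  have R: "R z = inverse (\<rho> * c) *\<^sub>R z"
    if z: "acoustic L w z = (\<rho> * c\<^sup>2) *\<^sub>R z" and "c > 0" for z c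
  proof -
    \<comment> \<open>Eigenvectors of a symmetric operator for different eigenvalues are orthogonal:
      either \<open>z \<bullet> b = 0\<close>, or the squared speeds agree and positivity gives
      \<open>\<kappa> b = c\<close>.\<close>
    have "inverse (\<rho> * \<kappa> b) * (z \<bullet> b) = inverse (\<rho> * c) * (z \<bullet> b)" if b: "b \<in> B" for b
    proof -
      have "(\<rho> * (\<kappa> b)\<^sup>2) * (z \<bullet> b) = (\<rho> * c\<^sup>2) * (z \<bullet> b)"
        using acoustic_symmetric[OF sym, of z w b] B(3)[OF b] z by (simp add: inner_commute)
      then have "z \<bullet> b = 0 \<or> (\<kappa> b)\<^sup>2 = c\<^sup>2" using \<open>\<rho> > 0\<close> by auto
      then show ?thesis using B(2)[OF b] \<open>c > 0\<close> by (auto simp: power2_eq_iff_nonneg)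
    qed
    then have "R z = (\<Sum>b\<in>B. (inverse (\<rho> * c) * (z \<bullet> b)) *\<^sub>R b)"
      unfolding R_def by (intro sum.cong) (simp_all del: inverse_mult_distrib)
    also have "\<dots> = inverse (\<rho> * c) *\<^sub>R (\<Sum>b\<in>B. (z \<bullet> b) *\<^sub>R b)"
      by (simp add: scaleR_sum_right)
    finally show ?thesis by (simp add: expand)
  qed
  have lR: "linear R"
    by (rule linearI)
      (simp_all add: R_def inner_add_left algebra_simps sum.distrib scaleR_sum_right)
  define T where "T = (\<lambda>z. (- (R z \<otimes>\<^sub>t w), z))"
  have lT: "linear T"
    by (rule linearI)
      (simp_all add: T_def linear_add[OF lR] linear_scale[OF lR]
        linear_add[OF linear_tensor_prod_left] linear_scale[OF linear_tensor_prod_left])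
  have iT: "inj T" by (rule injI) (simp add: T_def)
  have T: "T z = (- (inverse (\<rho> * c) *\<^sub>R (z \<otimes>\<^sub>t w)), z)"
    if "acoustic L w z = (\<rho> * c\<^sup>2) *\<^sub>R z" and "c > 0" for z c
    using R[OF that] by (simp add: T_def linear_scale[OF linear_tensor_prod_left])
  have "T ` B \<subseteq> ?X"
  proof (rule image_subsetI)
    fix b assume b: "b \<in> B"
    have "b \<noteq> 0" using B(1)[OF b] by auto
    with b have "proper_vector
        (hyperbolicity_operator (elasticity_flux (inverse \<rho> *\<^sub>R mat 1) Shat) w (F, p)) (\<kappa> b) (T b)"
      using T[OF B(3)[OF b] B(2)[OF b]] iff[of \<rho> "\<kappa> b"] B(3)[OF b] B(2)[OF b] \<open>\<rho> > 0\<close> by auto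
    then show "T b \<in> ?X" using B(2)[OF b] by blast
  qed
  then have "dim (T ` B) \<le> dim ?X" by (rule dim_subset)
  moreover have "?X \<subseteq> range T"
  proof
    fix x assume "x \<in> ?X"
    then obtain c Z z where "c > 0" "x = (Z, z)" "proper_vector
        (hyperbolicity_operator (elasticity_flux (inverse \<rho> *\<^sub>R mat 1) Shat) w (F, p)) c (Z, z)"
      by (cases x) blast
    then have "T z = x"
      using T[of z c] iff[of \<rho> c] \<open>\<rho> > 0\<close> by auto
    then show "x \<in> range T" by (metis rangeI)
  qed
  then have "dim ?X \<le> dim (range T)" by (rule dim_subset)
  moreover have "dim (T ` B) = 3" "dim (range T) = 3"
    using dim_image_eq[OF lT inj_on_subset[OF iT], of B] dim_image_eq[OF lT, of UNIV] iT
      dim_span[of B] B0(4) by simp_all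
  ultimately show ?thesis by simp
qed

text \<open>The linear involution \<open>(Z, z) \<mapsto> (- Z, z)\<close> reverses the sign of the
  proper number, so it carries one set bijectively onto the other.\<close>

lemma dim_elasticity_negative:
  fixes p w :: "real^3" and \<rho> :: real
  assumes L: "(Shat has_derivative L) (at F)"
  defines "M \<equiv> hyperbolicity_operator (elasticity_flux (inverse \<rho> *\<^sub>R mat 1) Shat) w (F, p)"
  shows "dim {x. \<exists>c<0. proper_vector M c x} = dim {x. \<exists>c>0. proper_vector M c x}"
proof -
  let ?r = "\<lambda>(Z :: tensor3, z :: vec3). (- Z, z)"
  have rev: "proper_vector M (- c) (?r x)" if "proper_vector M c x" for c x
    using proper_vector_reverse[OF L] that unfolding M_def by (cases x) simp
  have "{x. \<exists>c<0. proper_vector M c x} = ?r ` {x. \<exists>c>0. proper_vector M c x}"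
  proof (intro equalityI subsetI)
    fix x assume "x \<in> {x. \<exists>c<0. proper_vector M c x}"
    then obtain c where "c < 0" "proper_vector M c x" by blast
    then have "?r x \<in> {x. \<exists>c>0. proper_vector M c x}"
      using rev[of c x] by (auto intro!: exI[of _ "- c"])
    moreover have "x = ?r (?r x)" by (cases x) simp
    ultimately show "x \<in> ?r ` {x. \<exists>c>0. proper_vector M c x}" by (rule rev_image_eqI)
  next
    fix x assume "x \<in> ?r ` {x. \<exists>c>0. proper_vector M c x}"
    then obtain y c where "c > 0" "proper_vector M c y" "x = ?r y" by blast
    then show "x \<in> {x. \<exists>c<0. proper_vector M c x}"
      using rev[of c y] by (auto intro!: exI[of _ "- c"])
  qed
  moreover have "linear ?r" by (rule linearI) auto
  then have "dim (?r ` {x. \<exists>c>0. proper_vector M c x}) = dim {x. \<exists>c>0. proper_vector M c x}"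
    by (rule dim_image_eq) (auto intro: inj_onI)
  ultimately show ?thesis by (rule trans[OF arg_cong[where f=dim]])
qed

theorem proposition5:
  fixes \<sigma> :: "real^3^3 \<Rightarrow> real"
    and Shat :: "real^3^3 \<Rightarrow> real^3^3"
    and SS :: "real^3^3 \<Rightarrow> (real^3^3) \<Rightarrow>\<^sub>L (real^3^3)"
    and D :: "(real^3^3) set"
    and F :: "real^3^3" and p w :: "real^3" and \<rho> :: real
  assumes "open D"
    and stress: "\<And>A. A \<in> D \<Longrightarrow> GDERIV \<sigma> A :> Shat A"
    and elasticities: "\<And>A. A \<in> D \<Longrightarrow> (Shat has_derivative blinfun_apply (SS A)) (at A)"
    and C2: "continuous_on D SS"
    and "\<rho> > 0"
    and "F \<in> D"
    and strong_ellipticity: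
      "\<And>n u. norm n = 1 \<Longrightarrow> u \<noteq> 0 \<Longrightarrow> u \<bullet> acoustic (blinfun_apply (SS F)) n u > 0"
    and "norm w = 1"
  defines "M \<equiv> hyperbolicity_operator (elasticity_flux (inverse \<rho> *\<^sub>R mat 1) Shat) w (F, p)"
  shows "(\<exists>x. proper_vector M 0 x) \<and> dim (proper_space M 0) = 6 \<and>
    dim {x. \<exists>c>0. proper_vector M c x} = 3 \<and>
    dim {x. \<exists>c<0. proper_vector M c x} = 3 \<and>
    (\<exists>B. independent B \<and> card B = 3 \<and>
      (\<forall>z\<in>B. \<exists>c>0. \<exists>Z. proper_vector M c (Z, z) \<and> proper_vector M (- c) (- Z, z)))"
proof -
  define L where "L = blinfun_apply (SS F)"
  have L: "(Shat has_derivative L) (at F)"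
    unfolding L_def using \<open>F \<in> D\<close> by (rule elasticities)
  have sym: "A \<bullet> L B = B \<bullet> L A" for A B
    using \<open>open D\<close> \<open>F \<in> D\<close> stress L by (rule second_derivative_symmetric)
  have pos: "u \<bullet> acoustic L w u > 0" if "u \<noteq> 0" for u
    unfolding L_def using \<open>norm w = 1\<close> that by (rule strong_ellipticity)
  have "inj (acoustic L w)"
    unfolding linear_injective_0[OF linear_acoustic[OF has_derivative_linear[OF L]]]
    using pos by (metis inner_zero_right less_irrefl)
  moreover have "w \<noteq> 0" using \<open>norm w = 1\<close> by auto
  ultimately have ker: "dim (proper_space M 0) = 6"
    unfolding M_def using \<open>\<rho> > 0\<close> by (intro dim_elasticity_kernel[OF L]) auto
  have "\<exists>x. proper_vector M 0 x"
  proof (rule ccontr)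
    assume "\<not> ?thesis"
    then have "proper_space M 0 \<subseteq> {0}" by (auto simp: proper_space_def proper_vector_def)
    then have "dim (proper_space M 0) \<le> dim {0 :: tensor3 \<times> vec3}" by (rule dim_subset)
    with ker show False by simp
  qed
  moreover have dim_pos: "dim {x. \<exists>c>0. proper_vector M c x} = 3"
    unfolding M_def using L \<open>\<rho> > 0\<close> sym pos by (rule dim_elasticity_positive)
  moreover have "dim {x. \<exists>c<0. proper_vector M c x} = 3"
    using dim_elasticity_negative[OF L, of \<rho> w p] dim_pos unfolding M_def by simp
  moreover have "\<exists>B. independent B \<and> card B = 3 \<and>
      (\<forall>z\<in>B. \<exists>c>0. \<exists>Z. proper_vector M c (Z, z) \<and> proper_vector M (- c) (- Z, z))"
  proof -
    \<comment> \<open>The three wave directions are the acoustic eigenvectors; each \<open>b\<close>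
      carries two opposite waves, with proper numbers \<open>\<kappa> b\<close> and
      \<open>- \<kappa> b\<close>.\<close>
    obtain B \<kappa> where B: "finite B" "card B = 3" "pairwise orthogonal B" "span B = UNIV"
      "\<forall>b\<in>B. norm b = 1 \<and> \<kappa> b > 0 \<and> acoustic L w b = (\<rho> * (\<kappa> b)\<^sup>2) *\<^sub>R b"
      by (rule elasticity_eigenbasis[OF L \<open>\<rho> > 0\<close> sym pos])
    have "0 \<notin> B" using B(5) by force
    then have "independent B" using B(3) by (intro pairwise_orthogonal_independent)
    moreover have "\<exists>c>0. \<exists>Z. proper_vector M c (Z, b) \<and> proper_vector M (- c) (- Z, b)"
      if b: "b \<in> B" for b
    proof -
      have "b \<noteq> 0" and \<kappa>: "\<kappa> b > 0" "acoustic L w b = (\<rho> * (\<kappa> b)\<^sup>2) *\<^sub>R b"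
        using b \<open>0 \<notin> B\<close> B(5) by auto
      then have "\<exists>Z. proper_vector M (\<kappa> b) (Z, b)"
        unfolding M_def using elasticity_proper_vector_iff[OF L, of \<rho> "\<kappa> b"] \<open>\<rho> > 0\<close> \<kappa>
        by auto
      then show ?thesis
        using proper_vector_reverse[OF L] \<kappa>(1) unfolding M_def by blast
    qed
    ultimately show ?thesis using B(2) by blast
  qed
  ultimately show ?thesis using ker by blast
qed

end
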